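(* Consider a normalized Hamburger moment problem with recurrence coefficients $a_n\in\mathbb R$, $b_n>0$. Assume that $$\sum_{n=1}^\infty\frac{1+|a_n|}{\sqrt{b_nb_{n-1}}}<\infty,$$ and that there is $n_0\ge1$ such that either $b_n^2\le b_{n-1}b_{n+1}$ for all $n\ge n_0$, or $b_n^2\ge b_{n-1}b_{n+1}$ for all $n\ge n_0$. Then the order $\rho$ of the moment problem is given by $\rho=\mathcal E(b_n)$, the exponent of convergence of the sequence $(b_n)$.
   Context: A normalized Hamburger moment problem is given by a sequence $s_n=\int_{-\infty}^\infty x^n\,d\mu(x)$, $n\ge0$, where $\mu$ is a probability measure on $\mathbb R$ with infinite support and moments of every order. Its orthonormal polynomials $P_n$ satisfy $zP_n(z)=b_nP_{n+1}(z)+a_nP_n(z)+b_{n-1}P_{n-1}(z)$, $n\ge0$, with $a_n\in\mathbb R$, $b_n>0$ for $n\ge 0$, $b_{-1}=1$, $P_0=1$, $P_{-1}=0$. Put $P(z)=(\sum_{n\ge0}|P_n(z)|^2)^{1/2}$, which is finite and continuous on $\mathbb C$ when the moment problem is indeterminate (more than one measure with the given moments). The hypotheses of the claim are known to imply indeterminacy and that $b_n\to\infty$. For an unbounded continuous $f:\mathbb C\to\mathbb C$ let $M_f(r)=\max_{|z|\le r}|f(z)|$; the order of $f$ is $\rho_f=\inf\{a>0\mid \log M_f(r)\le r^a\text{ for all sufficiently large }r\}$. The order $\rho$ of an indeterminate moment problem is the order of $P$ (it is known that $(\sum_n|Q_n(z)|^2)^{1/2}$, with $Q_n$ the polynomials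 of the second kind, and the four entire Nevanlinna functions $A,B,C,D$ have the same order). For a sequence $(z_n)$ of complex numbers with $|z_n|\to\infty$ the exponent of convergence is $\mathcal E(z_n)=\inf\{a>0\mid\sum_{n\ge n^*}|z_n|^{-a}<\infty\}$, where $n^*$ is such that $|z_n|>0$ for $n\ge n^*$. *)

theory Defs
  imports "HOL-Probability.Probability" "HOL-Computational_Algebra.Polynomial"
begin

definition measure_support :: "'a::topological_space measure \<Rightarrow> 'a set" where
  "measure_support M = {x. \<forall>U. open U \<longrightarrow> x \<in> U \<longrightarrow> emeasure M U > 0}"

definition normalized_hamburger_problem :: "(nat \<Rightarrow> real) \<Rightarrow> real measure \<Rightarrow> bool" where
  "normalized_hamburger_problem s \<mu> \<longleftrightarrow>
     prob_space \<mu> \<and> sets \<mu> = sets borel \<and> infinite (measure_support \<mu>) \<and>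
     (\<forall>n. integrable \<mu> (\<lambda>x. x ^ n) \<and> s n = (\<integral>x. x ^ n \<partial>\<mu>))"

text \<open>The sign normalization \<open>lead_coeff (p n) > 0\<close> makes the sequence unique, and gives
  \<open>p 0 = 1\<close> when \<open>\<mu>\<close> is a probability measure.\<close>

definition orthonormal_polys :: "real measure \<Rightarrow> (nat \<Rightarrow> real poly) \<Rightarrow> bool" where
  "orthonormal_polys \<mu> p \<longleftrightarrow>
     (\<forall>n. degree (p n) = n \<and> lead_coeff (p n) > 0) \<and>
     (\<forall>m n. (\<integral>x. poly (p m) x * poly (p n) x \<partial>\<mu>) = (if m = n then 1 else 0))"

text \<open>The conditional implements the convention \<open>p (-1) = 0\<close>; the value of \<open>b (-1)\<close> is then
  irrelevant.\<close>

definition recurrence_coeffs ::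
  "(nat \<Rightarrow> real poly) \<Rightarrow> (nat \<Rightarrow> real) \<Rightarrow> (nat \<Rightarrow> real) \<Rightarrow> bool" where
  "recurrence_coeffs p a b \<longleftrightarrow>
     (\<forall>n. b n > 0) \<and>
     (\<forall>n. [:0, 1:] * p n =
        smult (b n) (p (Suc n)) + smult (a n) (p n) +
        (if n = 0 then 0 else smult (b (n - 1)) (p (n - 1))))"

definition max_modulus :: "(complex \<Rightarrow> 'a::real_normed_vector) \<Rightarrow> real \<Rightarrow> real" where
  "max_modulus f r = (SUP z\<in>cball 0 r. norm (f z))"

text \<open>The infima below are taken in the extended reals, so that the infimum of the empty set is
  \<open>\<infinity>\<close>.\<close>

definition growth_order :: "(complex \<Rightarrow> 'a::real_normed_vector) \<Rightarrow> ereal" where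
  "growth_order f =
     Inf (ereal ` {\<alpha>. \<alpha> > 0 \<and> (\<forall>\<^sub>F r in at_top. ln (max_modulus f r) \<le> r powr \<alpha>)})"

definition exponent_of_convergence :: "(nat \<Rightarrow> 'a::real_normed_vector) \<Rightarrow> ereal" where
  "exponent_of_convergence z =
     Inf (ereal ` {\<alpha>. \<alpha> > 0 \<and>
       (\<exists>N. (\<forall>n\<ge>N. norm (z n) > 0) \<and> summable (\<lambda>n. norm (z (n + N)) powr (- \<alpha>)))})"

text \<open>The series below converges for every \<open>z\<close>, and \<open>orthonormal_norm p\<close> is continuous, when the
  moment problem is indeterminate; only then does \<open>moment_problem_order\<close> have its intended
  meaning.\<close>

definition orthonormal_norm :: "(nat \<Rightarrow> real poly) \<Rightarrow> complex \<Rightarrow> real" where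
  "orthonormal_norm p z = sqrt (\<Sum>n. (cmod (poly (map_poly complex_of_real (p n)) z))\<^sup>2)"

definition moment_problem_order :: "(nat \<Rightarrow> real poly) \<Rightarrow> ereal" where
  "moment_problem_order p = growth_order (orthonormal_norm p)"

end

theory Submission
  imports Defs "HOL-Complex_Analysis.Complex_Analysis" "HOL-Real_Asymp.Real_Asymp"
begin

text \<open>Summability of \<open>1 / sqrt (b (n + 1) * b n)\<close> and log-monotonicity force \<open>b\<close> to be eventually
  nondecreasing with summable inverses, so only exponents at most 1 matter for the upper bound.
  With suitable weights \<open>c n \<ge> sqrt (b (n - 1))\<close>, the recurrence shows that \<open>c n * |P n z|\<close> grows at
  step \<open>n\<close> by at most the factor \<open>1 + (|z| + |a n|) / sqrt (b n * b (n - 1))\<close>; since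
  \<open>1 + x \<le> exp (x powr \<alpha> / \<alpha>)\<close> for \<open>0 < \<alpha> \<le> 1\<close>, the product of these factors is
  \<open>exp (O(|z| powr \<alpha>))\<close> whenever \<open>b n powr (- \<alpha>)\<close> is summable. Conversely, Cauchy's inequality
  bounds the maximum modulus from below by the leading term \<open>r ^ (n + 1) / (b 0 \<cdots> b n)\<close>, which for
  \<open>r = e * b n\<close> is at least \<open>exp (n + 1)\<close>; so growth of order \<open>\<alpha>\<close> forces \<open>b n powr \<alpha>\<close> to grow at
  least linearly in \<open>n\<close>.\<close>

section \<open>Elementary inequalities for powers and products\<close>

text \<open>On the unit interval \<open>t \<le> t powr \<alpha>\<close>. Applied to two fractions
  with sum 1, this yields \<open>(1 + x) powr \<alpha> \<le> 1 + x powr \<alpha>\<close>, and taking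
  logarithms produces the division by \<alpha>.\<close>

lemma one_plus_le_exp_powr:
  fixes x \<alpha> :: real
  assumes "x \<ge> 0" "0 < \<alpha>" "\<alpha> \<le> 1"
  shows "1 + x \<le> exp (x powr \<alpha> / \<alpha>)"
proof -
  have le: "t \<le> t powr \<alpha>" if "0 \<le> t" "t \<le> 1" for t :: real
    using that assms powr_mono'[of \<alpha> 1 t] by (cases "t = 0") auto
  have "1 = 1 / (1 + x) + x / (1 + x)"
    using assms by (simp add: field_simps)
  also have "\<dots> \<le> (1 / (1 + x)) powr \<alpha> + (x / (1 + x)) powr \<alpha>"
    using assms by (intro add_mono le) (auto simp: field_simps)
  also have "\<dots> = (1 + x powr \<alpha>) / (1 + x) powr \<alpha>"
    using assms by (simp add: powr_divide add_divide_distrib)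
  finally have "(1 + x) powr \<alpha> \<le> 1 + x powr \<alpha>"
    using assms by (simp add: field_simps)
  also have "\<dots> \<le> exp (x powr \<alpha>)"
    by (rule exp_ge_add_one_self)
  finally have "\<alpha> * ln (1 + x) \<le> x powr \<alpha>"
    using assms by (simp add: powr_def)
  then have "ln (1 + x) \<le> x powr \<alpha> / \<alpha>"
    using assms by (simp add: field_simps)
  then have "exp (ln (1 + x)) \<le> exp (x powr \<alpha> / \<alpha>)"
    by simp
  then show ?thesis
    using assms by simp
qed

text \<open>Since the recursion reaches back two steps, the induction keeps \<open>w n\<close> and
  \<open>w (Suc n)\<close> under one common bound; the coefficient 1 of \<open>w n\<close> makes
  each step cost exactly a factor \<open>1 + d n\<close>.\<close>

lemma three_term_inequality_bound:
  fixes w d :: "nat \<Rightarrow> real"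
  assumes "\<And>n. w n \<ge> 0" "\<And>n. d n \<ge> 0"
    and "\<And>n. w (Suc (Suc n)) \<le> d n * w (Suc n) + w n"
  shows "w n \<le> (w 0 + w 1) * (\<Prod>k<n. 1 + d k)"
proof -
  have "w n \<le> (w 0 + w 1) * (\<Prod>k<n. 1 + d k) \<and> w (Suc n) \<le> (w 0 + w 1) * (\<Prod>k<n. 1 + d k)"
  proof (induction n)
    case 0
    then show ?case using assms(1)[of 0] assms(1)[of 1] by simp
  next
    case (Suc n)
    define B where "B = (w 0 + w 1) * (\<Prod>k<n. 1 + d k)"
    have B: "w n \<le> B" "w (Suc n) \<le> B"
      using Suc by (auto simp: B_def)
    have B': "(w 0 + w 1) * (\<Prod>k<Suc n. 1 + d k) = B + d n * B"
      by (simp add: B_def algebra_simps)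
    have "w (Suc (Suc n)) \<le> d n * w (Suc n) + w n"
      by (rule assms)
    also have "\<dots> \<le> d n * B + B"
      using B assms(2)[of n] by (intro add_mono mult_left_mono) auto
    finally have "w (Suc (Suc n)) \<le> B + d n * B" by simp
    moreover have "0 \<le> d n * B"
      using B(1) assms(1)[of n] assms(2)[of n] by (intro mult_nonneg_nonneg) linarith+
    ultimately show ?case
      using B(2) unfolding B' by linarith
  qed
  then show ?thesis ..
qed

text \<open>Splitting off \<open>1 + u k\<close> leaves \<open>1 + r * t k\<close>, to which the
  power inequality applies, so that \<open>r\<close> enters only as \<open>r powr \<alpha>\<close>.
  The bound is uniform in \<open>n\<close>.\<close>

lemma prod_one_plus_le_exp:
  fixes u t :: "nat \<Rightarrow> real" and r \<alpha> :: real
  assumes "\<And>k. u k \<ge> 0" "\<And>k. t k \<ge> 0" "r \<ge> 0" "0 < \<alpha>" "\<alpha> \<le> 1"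
    and "summable u" "summable (\<lambda>k. t k powr \<alpha>)"
  shows "(\<Prod>k<n. 1 + (u k + r * t k)) \<le> exp (suminf u + (\<Sum>k. t k powr \<alpha>) / \<alpha> * r powr \<alpha>)"
proof -
  have "(\<Prod>k<n. 1 + (u k + r * t k)) \<le> (\<Prod>k<n. exp (u k + t k powr \<alpha> / \<alpha> * r powr \<alpha>))"
  proof (intro prod_mono conjI)
    fix k
    show "0 \<le> 1 + (u k + r * t k)" using assms by (simp add: add_nonneg_nonneg)
    have "1 + (u k + r * t k) \<le> (1 + u k) * (1 + r * t k)"
      using assms by (simp add: algebra_simps)
    also have "\<dots> \<le> exp (u k) * exp ((r * t k) powr \<alpha> / \<alpha>)"
      using assms by (intro mult_mono exp_ge_add_one_self one_plus_le_exp_powr) auto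
    also have "\<dots> = exp (u k + t k powr \<alpha> / \<alpha> * r powr \<alpha>)"
      using assms by (simp add: exp_add powr_mult mult_ac)
    finally show "1 + (u k + r * t k) \<le> exp (u k + t k powr \<alpha> / \<alpha> * r powr \<alpha>)" .
  qed
  also have "\<dots> = exp ((\<Sum>k<n. u k) + (\<Sum>k<n. t k powr \<alpha>) / \<alpha> * r powr \<alpha>)"
    by (simp add: exp_sum[symmetric] sum.distrib sum_distrib_right sum_divide_distrib)
  also have "\<dots> \<le> exp (suminf u + (\<Sum>k. t k powr \<alpha>) / \<alpha> * r powr \<alpha>)"
    using assms unfolding exp_le_cancel_iff
    by (intro add_mono mult_right_mono divide_right_mono sum_le_suminf) auto
  finally show ?thesis .
qed

section \<open>Polynomial estimates and comparison of infima\<close>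

lemma poly_growth_bound:
  fixes q :: "'a::real_normed_field poly"
  assumes "degree q \<le> M"
  shows "norm (poly q z) \<le> (\<Sum>i\<le>M. norm (coeff q i)) * (1 + norm z) ^ M"
proof -
  have "poly q z = (\<Sum>i\<le>M. coeff q i * z ^ i)"
    using assms unfolding poly_altdef
    by (intro sum.mono_neutral_left) (auto simp: coeff_eq_0)
  then have "norm (poly q z) = norm (\<Sum>i\<le>M. coeff q i * z ^ i)"
    by simp
  also have "\<dots> \<le> (\<Sum>i\<le>M. norm (coeff q i) * norm z ^ i)"
    by (intro sum_norm_le) (simp add: norm_mult norm_power)
  also have "\<dots> \<le> (\<Sum>i\<le>M. norm (coeff q i) * (1 + norm z) ^ M)"
  proof (intro sum_mono mult_left_mono)
    fix i assume "i \<in> {..M}"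
    have "norm z ^ i \<le> (1 + norm z) ^ i" by (intro power_mono) auto
    also have "\<dots> \<le> (1 + norm z) ^ M" using \<open>i \<in> {..M}\<close> by (intro power_increasing) auto
    finally show "norm z ^ i \<le> (1 + norm z) ^ M" .
  qed auto
  finally show ?thesis by (simp add: sum_distrib_right)
qed

lemma higher_deriv_poly:
  "(deriv ^^ n) (poly q) = poly ((pderiv ^^ n) (q :: complex poly))"
proof (induction n)
  case (Suc n)
  have "deriv (poly r) = poly (pderiv r)" for r :: "complex poly"
    by (rule ext) (rule DERIV_imp_deriv, rule poly_DERIV)
  then show ?case using Suc by simp
qed auto

text \<open>Cauchy's inequality at 0, where the \<open>n\<close>-th derivative is
  \<open>fact n\<close> times the coefficient.\<close>

lemma coeff_le_of_bound_on_circle: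
  fixes q :: "complex poly"
  assumes "r > 0" and "\<And>z. cmod z = r \<Longrightarrow> cmod (poly q z) \<le> B"
  shows "cmod (coeff q n) * r ^ n \<le> B"
proof -
  have "cmod ((deriv ^^ n) (poly q) 0) \<le> fact n * B / r ^ n"
    using assms by (intro Cauchy_inequality) (auto intro!: continuous_intros holomorphic_intros)
  also have "(deriv ^^ n) (poly q) 0 = fact n * coeff q n"
    by (simp add: higher_deriv_poly poly_0_coeff_0 coeff_higher_pderiv pochhammer_fact)
  finally show ?thesis
    using assms by (simp add: norm_mult field_simps)
qed

text \<open>An admissible exponent for one quantity will only yield all strictly larger exponents
  for the other; the infimum does not see this loss.\<close>

lemma Inf_ereal_image_le:
  fixes A B :: "real set"
  assumes "\<And>x y. x \<in> A \<Longrightarrow> x < y \<Longrightarrow> y \<in> B"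
  shows "Inf (ereal ` B) \<le> Inf (ereal ` A)"
proof (rule Inf_greatest)
  fix e assume "e \<in> ereal ` A"
  then obtain x where x: "x \<in> A" "e = ereal x" by auto
  have "Inf (ereal ` B) \<le> e + ereal h" if "h > 0" for h
  proof -
    have "x + h \<in> B" using x assms that by auto
    then show ?thesis using x by (auto intro: Inf_lower)
  qed
  then show "Inf (ereal ` B) \<le> e"
    by (rule ereal_le_epsilon2)
qed

section \<open>Log-monotone sequences and their weights\<close>

text \<open>If \<open>b\<close> were nonincreasing from \<open>k\<close> on, the summands would stay
  above \<open>1 / b k\<close>. Log-convexity makes the ratios \<open>b (Suc n) / b n\<close>
  nondecreasing, so one increase persists; log-concavity makes them nonincreasing, so one decrease
  would persist, which is excluded.\<close>

lemma eventually_mono_of_log_monotone: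
  fixes b :: "nat \<Rightarrow> real"
  assumes pos: "\<And>n. b n > 0" and sum: "summable (\<lambda>n. 1 / sqrt (b (Suc n) * b n))"
    and mon: "(\<forall>n\<ge>n0. (b (Suc n))\<^sup>2 \<le> b n * b (Suc (Suc n))) \<or>
              (\<forall>n\<ge>n0. (b (Suc n))\<^sup>2 \<ge> b n * b (Suc (Suc n)))"
  obtains N where "N \<ge> n0" "\<And>n. n \<ge> N \<Longrightarrow> b n \<le> b (Suc n)"
proof -
  have nodecr: "\<not> (\<forall>n\<ge>k. b (Suc n) \<le> b n)" for k
  proof
    assume *: "\<forall>n\<ge>k. b (Suc n) \<le> b n"
    have le: "b n \<le> b k" if "n \<ge> k" for n
      using that by (induction n rule: dec_induct) (use * in force)+
    have "(\<lambda>n. 1 / sqrt (b (Suc n) * b n)) \<longlonglongrightarrow> 0"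
      using sum by (rule summable_LIMSEQ_zero)
    moreover have "\<forall>\<^sub>F n in sequentially. 1 / b k \<le> 1 / sqrt (b (Suc n) * b n)"
      using eventually_ge_at_top[of k]
    proof eventually_elim
      case (elim n)
      have "b (Suc n) * b n \<le> b k * b k"
        using elim le pos by (intro mult_mono) (auto intro: less_imp_le)
      then have "sqrt (b (Suc n) * b n) \<le> b k"
        using pos[of k] by (intro real_le_lsqrt) (auto simp: power2_eq_square)
      then show ?case using pos by (intro divide_left_mono) auto
    qed
    ultimately have "1 / b k \<le> 0"
      by (rule tendsto_lowerbound) simp
    then show False using pos[of k] by (simp add: field_simps)
  qed
  from mon show thesis
  proof
    assume convex: "\<forall>n\<ge>n0. (b (Suc n))\<^sup>2 \<le> b n * b (Suc (Suc n))"
    obtain N where N: "N \<ge> n0" "b N \<le> b (Suc N)"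
      using nodecr[of n0] by (meson linear)
    have "b n \<le> b (Suc n)" if "n \<ge> N" for n
      using that
    proof (induction n rule: dec_induct)
      case (step n)
      have "b (Suc n) * b (Suc n) \<le> b n * b (Suc (Suc n))"
        using convex N step by (simp add: power2_eq_square)
      also have "\<dots> \<le> b (Suc n) * b (Suc (Suc n))"
        using step pos by (intro mult_right_mono) (auto intro: less_imp_le)
      finally show ?case using pos[of "Suc n"] by simp
    qed (use N in auto)
    then show thesis using N that by blast
  next
    assume concave: "\<forall>n\<ge>n0. (b (Suc n))\<^sup>2 \<ge> b n * b (Suc (Suc n))"
    have "b n \<le> b (Suc n)" if "n \<ge> n0" for n
    proof (rule ccontr)
      assume "\<not> b n \<le> b (Suc n)"
      have "b (Suc k) \<le> b k" if "k \<ge> n" for k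
        using that
      proof (induction k rule: dec_induct)
        case (step k)
        have "b k * b (Suc (Suc k)) \<le> b (Suc k) * b (Suc k)"
          using concave step \<open>n \<ge> n0\<close> by (simp add: power2_eq_square)
        also have "\<dots> \<le> b k * b (Suc k)"
          using step pos by (intro mult_right_mono) (auto intro: less_imp_le)
        finally show ?case using pos[of k] by simp
      qed (use \<open>\<not> b n \<le> b (Suc n)\<close> in auto)
      then show False using nodecr[of n] by blast
    qed
    then show thesis using that by blast
  qed
qed

text \<open>The weights make the modulus of a solution of the three-term recurrence with \<open>z = a n = 0\<close>
  nonincreasing along each parity class: \<open>c n = sqrt (b (n - 1))\<close> in the log-convex case and
  \<open>c n = sqrt (b n)\<close> in the log-concave case.\<close>

lemma log_monotone_weights:
  fixes b :: "nat \<Rightarrow> real"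
  assumes pos: "\<And>n. b n > 0"
    and incr: "\<And>n. n \<ge> m \<Longrightarrow> b n \<le> b (Suc n)"
    and mon: "(\<forall>n\<ge>m. (b (Suc n))\<^sup>2 \<le> b n * b (Suc (Suc n))) \<or>
              (\<forall>n\<ge>m. (b (Suc n))\<^sup>2 \<ge> b n * b (Suc (Suc n)))"
  obtains c :: "nat \<Rightarrow> real" where "\<And>n. c n > 0" "\<And>n. n \<ge> m \<Longrightarrow> b n \<le> (c (Suc n))\<^sup>2"
    "\<And>n. n > m \<Longrightarrow> c (Suc (Suc n)) * b n \<le> b (Suc n) * c n"
    "\<And>n. n > m \<Longrightarrow> c (Suc (Suc n)) * sqrt (b (Suc n) * b n) \<le> b (Suc n) * c (Suc n)"
  using mon
proof
  assume convex: "\<forall>n\<ge>m. (b (Suc n))\<^sup>2 \<le> b n * b (Suc (Suc n))"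
  \<comment> \<open>Truncated subtraction gives \<open>c 0 = sqrt (b 0)\<close>, so \<open>c\<close>
    is positive everywhere.\<close>
  define c where "c n = sqrt (b (n - 1))" for n
  have 1: "c (Suc (Suc n)) * b n \<le> b (Suc n) * c n" if "n > m" for n
  proof -
    define k where "k = n - 1"
    have n: "n = Suc k" "k \<ge> m" using that by (auto simp: k_def)
    \<comment> \<open>The square of the claim is log-convexity at \<open>k\<close> multiplied by
      \<open>b (Suc (Suc k))\<close>.\<close>
    have "(b (Suc k))\<^sup>2 * b (Suc (Suc k)) \<le> b k * b (Suc (Suc k)) * b (Suc (Suc k))"
      using convex n pos[of "Suc (Suc k)"] by (intro mult_right_mono) auto
    then have "b (Suc (Suc k)) * (b (Suc k))\<^sup>2 \<le> (b (Suc (Suc k)))\<^sup>2 * b k"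
      by (simp add: power2_eq_square mult_ac)
    then have "sqrt (b (Suc (Suc k)) * (b (Suc k))\<^sup>2) \<le> sqrt ((b (Suc (Suc k)))\<^sup>2 * b k)"
      by (rule real_sqrt_le_mono)
    then show ?thesis
      using pos[of "Suc k"] pos[of "Suc (Suc k)"] by (simp add: c_def n real_sqrt_mult)
  qed
  have 2: "c (Suc (Suc n)) * sqrt (b (Suc n) * b n) \<le> b (Suc n) * c (Suc n)" for n
  proof -
    have "sqrt (b (Suc n)) * sqrt (b (Suc n)) = b (Suc n)"
      using pos[of "Suc n"] by simp
    then show ?thesis
      by (simp add: c_def real_sqrt_mult flip: mult.assoc)
  qed
  have 3: "c n > 0" "b n \<le> (c (Suc n))\<^sup>2" for n
    using pos[of "n - 1"] pos[of n] by (simp_all add: c_def)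
  show thesis
    by (rule that[of c]) (assumption | rule 1 2 3)+
next
  assume concave: "\<forall>n\<ge>m. (b (Suc n))\<^sup>2 \<ge> b n * b (Suc (Suc n))"
  define c where "c n = sqrt (b n)" for n
  \<comment> \<open>The square root of log-concavity; multiplying it by \<open>c n\<close> or
    \<open>c (Suc n)\<close> gives the two recurrence inequalities.\<close>
  have *: "c n * c (Suc (Suc n)) \<le> b (Suc n)" if "n \<ge> m" for n
  proof -
    have "sqrt (b n * b (Suc (Suc n))) \<le> sqrt ((b (Suc n))\<^sup>2)"
      using concave that by (intro real_sqrt_le_mono) blast
    then show ?thesis using pos[of "Suc n"] by (simp add: c_def real_sqrt_mult)
  qed
  have b: "b n = c n * c n" "c n > 0" for n
    using pos[of n] by (simp_all add: c_def)
  have 1: "c (Suc (Suc n)) * b n \<le> b (Suc n) * c n" if "n > m" for n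
  proof -
    have "c (Suc (Suc n)) * b n = c n * c (Suc (Suc n)) * c n"
      by (simp add: b(1))
    also have "\<dots> \<le> b (Suc n) * c n"
      using * that b(2)[of n] by (intro mult_right_mono) auto
    finally show ?thesis .
  qed
  have 2: "c (Suc (Suc n)) * sqrt (b (Suc n) * b n) \<le> b (Suc n) * c (Suc n)" if "n > m" for n
  proof -
    have "c (Suc (Suc n)) * sqrt (b (Suc n) * b n) = c n * c (Suc (Suc n)) * c (Suc n)"
      by (simp add: real_sqrt_mult c_def)
    also have "\<dots> \<le> b (Suc n) * c (Suc n)"
      using * that b(2)[of "Suc n"] by (intro mult_right_mono) auto
    finally show ?thesis .
  qed
  \<comment> \<open>Here \<open>(c (Suc n))\<^sup>2\<close> is \<open>b (Suc n)\<close>, so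
    monotonicity enters.\<close>
  have 3: "b n \<le> (c (Suc n))\<^sup>2" if "n \<ge> m" for n
    using incr[OF that] pos[of "Suc n"] by (simp add: c_def)
  show thesis
    by (rule that[of c]) (assumption | rule b(2) 1 2 3)+
qed

section \<open>Recurrence and leading coefficients over the complex plane\<close>

abbreviation cpoly :: "real poly \<Rightarrow> complex \<Rightarrow> complex" where
  "cpoly q \<equiv> poly (map_poly complex_of_real q)"

lemma cpoly_simps:
  "cpoly (q + r) z = cpoly q z + cpoly r z"
  "cpoly (smult c q) z = of_real c * cpoly q z"
  "cpoly ([:0, 1:] * q) z = z * cpoly q z"
proof -
  have "map_poly complex_of_real (q + r) = map_poly of_real q + map_poly of_real r"
    by (intro poly_eqI) (simp add: coeff_map_poly)
  then show "cpoly (q + r) z = cpoly q z + cpoly r z"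
    by simp
  have "map_poly complex_of_real (smult c q) = smult (of_real c) (map_poly of_real q)"
    by (intro poly_eqI) (simp add: coeff_map_poly)
  then show "cpoly (smult c q) z = of_real c * cpoly q z"
    by simp
  have "map_poly complex_of_real (pCons 0 q) = pCons 0 (map_poly of_real q)"
    by (simp add: map_poly_pCons)
  then show "cpoly ([:0, 1:] * q) z = z * cpoly q z"
    by simp
qed

lemma recurrence_coeffs_pos: "recurrence_coeffs p a b \<Longrightarrow> b n > 0"
  by (simp add: recurrence_coeffs_def)

lemma recurrence_coeffs_cpoly:
  assumes "recurrence_coeffs p a b"
  shows "b (Suc n) * cpoly (p (Suc (Suc n))) z =
    (z - a (Suc n)) * cpoly (p (Suc n)) z - b n * cpoly (p n) z"
proof -
  have "[:0, 1:] * p (Suc n) =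
      smult (b (Suc n)) (p (Suc (Suc n))) + smult (a (Suc n)) (p (Suc n)) + smult (b n) (p n)"
    using assms(1)[unfolded recurrence_coeffs_def, THEN conjunct2, rule_format, of "Suc n"]
    by (simp only: nat.distinct(2) if_False diff_Suc_1)
  then have "cpoly ([:0, 1:] * p (Suc n)) z =
      cpoly (smult (b (Suc n)) (p (Suc (Suc n))) + smult (a (Suc n)) (p (Suc n)) + smult (b n) (p n)) z"
    by simp
  then show ?thesis
    unfolding cpoly_simps by (simp add: algebra_simps)
qed

text \<open>Compares coefficients of degree \<open>Suc n\<close>, to which the last two terms of the
  recurrence do not contribute.\<close>

lemma recurrence_coeffs_lead_coeff:
  assumes "recurrence_coeffs p a b" and deg: "\<And>n. degree (p n) = n"
  shows "b n * lead_coeff (p (Suc n)) = lead_coeff (p n)"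
proof -
  have "coeff ([:0, 1:] * p n) (Suc n) = coeff (smult (b n) (p (Suc n)) + smult (a n) (p n) +
        (if n = 0 then 0 else smult (b (n - 1)) (p (n - 1)))) (Suc n)"
    using assms(1) unfolding recurrence_coeffs_def by simp
  then have "coeff (p n) n = b n * coeff (p (Suc n)) (Suc n)"
    by (simp add: coeff_eq_0 deg split: if_splits)
  then show ?thesis
    by (simp add: deg)
qed

lemma lead_coeff_times_prod:
  assumes "recurrence_coeffs p a b" "\<And>n. degree (p n) = n"
  shows "lead_coeff (p n) * (\<Prod>k<n. b k) = lead_coeff (p 0)"
proof (induction n)
  case (Suc n)
  have "lead_coeff (p (Suc n)) * (\<Prod>k<Suc n. b k) = (b n * lead_coeff (p (Suc n))) * (\<Prod>k<n. b k)"
    by (simp add: mult_ac)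
  then show ?case
    using Suc by (simp only: recurrence_coeffs_lead_coeff[OF assms])
qed simp

text \<open>Covers the finitely many indices up to the start of the weighted recursion; they add
  only a polynomial factor.\<close>

lemma cpoly_degree_growth:
  assumes "\<And>n. degree (p n) = n"
  obtains D where "D \<ge> 0" "\<And>k z. k \<le> M \<Longrightarrow> cmod (cpoly (p k) z) \<le> D * (1 + cmod z) ^ M"
proof
  define D where "D = (\<Sum>k\<le>M. \<Sum>i\<le>M. cmod (coeff (map_poly of_real (p k)) i))"
  show "D \<ge> 0"
    by (auto simp: D_def intro!: sum_nonneg)
  show "cmod (cpoly (p k) z) \<le> D * (1 + cmod z) ^ M" if "k \<le> M" for k z
  proof -
    have "degree (map_poly complex_of_real (p k)) \<le> M"
      using map_poly_degree_leq[of complex_of_real "p k"] assms[of k] that by simp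
    then have "cmod (cpoly (p k) z) \<le>
        (\<Sum>i\<le>M. cmod (coeff (map_poly of_real (p k)) i)) * (1 + cmod z) ^ M"
      by (rule poly_growth_bound)
    also have "\<dots> \<le> D * (1 + cmod z) ^ M"
      unfolding D_def using that by (intro mult_right_mono member_le_sum sum_nonneg) auto
    finally show ?thesis .
  qed
qed

section \<open>Upper bound for the growth\<close>

text \<open>The weighted moduli satisfy the three-term inequality beyond \<open>m\<close>, with a
  bound uniform in \<open>n\<close>. Dividing by the squared weights leaves a series dominated by
  the inverses of \<open>b\<close>.\<close>

lemma orthonormal_norm_growth:
  assumes rec: "recurrence_coeffs p a b" and deg: "\<And>n. degree (p n) = n"
    and sum: "summable (\<lambda>n. (1 + \<bar>a (Suc n)\<bar>) / sqrt (b (Suc n) * b n))"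
    and incr: "\<And>n. n \<ge> m \<Longrightarrow> b n \<le> b (Suc n)"
    and mon: "(\<forall>n\<ge>m. (b (Suc n))\<^sup>2 \<le> b n * b (Suc (Suc n))) \<or>
              (\<forall>n\<ge>m. (b (Suc n))\<^sup>2 \<ge> b n * b (Suc (Suc n)))"
    and sumb: "summable (\<lambda>n. 1 / b n)"
    and \<alpha>: "0 < \<alpha>" "\<alpha> \<le> 1" and sum\<alpha>: "summable (\<lambda>n. b n powr (- \<alpha>))"
  obtains E L M where "E > 0" "L \<ge> 0"
    "\<And>z. summable (\<lambda>n. (cmod (cpoly (p n) z))\<^sup>2)"
    "\<And>z. orthonormal_norm p z \<le> E * ((1 + cmod z) ^ M * exp (L * cmod z powr \<alpha>))"
proof -
  note pos = recurrence_coeffs_pos[OF rec]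
  obtain c :: "nat \<Rightarrow> real" where c: "\<And>n. c n > 0" "\<And>n. n \<ge> m \<Longrightarrow> b n \<le> (c (Suc n))\<^sup>2"
    and c1: "\<And>n. n > m \<Longrightarrow> c (Suc (Suc n)) * b n \<le> b (Suc n) * c n"
    and c2: "\<And>n. n > m \<Longrightarrow> c (Suc (Suc n)) * sqrt (b (Suc n) * b n) \<le> b (Suc n) * c (Suc n)"
    using log_monotone_weights[OF pos incr mon] by blast
  \<comment> \<open>\<open>N\<close> is the first index where the weight inequalities hold;
    \<open>N\<close> and \<open>M\<close> are the indices of the two starting values.\<close>
  define M N where "M = Suc (Suc m)" and "N = Suc m"
  obtain D where D: "D \<ge> 0" "\<And>k z. k \<le> M \<Longrightarrow> cmod (cpoly (p k) z) \<le> D * (1 + cmod z) ^ M"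
    using cpoly_degree_growth[OF deg] by blast
  define t where "t n = 1 / sqrt (b (Suc (N + n)) * b (N + n))" for n
  define u where "u n = \<bar>a (Suc (N + n))\<bar> * t n" for n
  have t0: "t n > 0" and u0: "u n \<ge> 0" for n
    using pos by (auto simp: t_def u_def less_imp_le)
  have sum': "summable (\<lambda>n. (1 + \<bar>a (Suc (N + n))\<bar>) * t n)"
    using summable_ignore_initial_segment[OF sum, of N] by (simp add: t_def add.commute)
  have sumu: "summable u"
    using t0 u0 by (intro summable_comparison_test'[OF sum']) (auto simp: u_def algebra_simps less_imp_le)
  have sumt: "summable (\<lambda>n. t n powr \<alpha>)"
  proof (rule summable_comparison_test')
    show "summable (\<lambda>n. b (N + n) powr (- \<alpha>))"
      using summable_ignore_initial_segment[OF sum\<alpha>, of N] by (simp add: add.commute)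
    fix n
    \<comment> \<open>Monotonicity replaces the geometric mean by its smaller factor.\<close>
    have "b (N + n) * b (N + n) \<le> b (Suc (N + n)) * b (N + n)"
      using pos incr by (intro mult_right_mono) (auto simp: N_def less_imp_le)
    then have "b (N + n) \<le> sqrt (b (Suc (N + n)) * b (N + n))"
      by (intro real_le_rsqrt) (simp add: power2_eq_square)
    then have "t n \<le> 1 / b (N + n)"
      unfolding t_def using pos by (intro divide_left_mono) auto
    then have "t n powr \<alpha> \<le> (1 / b (N + n)) powr \<alpha>"
      using t0 \<alpha> by (intro powr_mono2) (auto simp: less_imp_le)
    then show "norm (t n powr \<alpha>) \<le> b (N + n) powr (- \<alpha>)"
      using pos[of "N + n"] by (simp add: powr_divide powr_minus_divide)
  qed
  define U L where "U = suminf u" and "L = (\<Sum>n. t n powr \<alpha>) / \<alpha>"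
  have L: "L \<ge> 0"
    using \<alpha> sumt by (auto simp: L_def intro!: divide_nonneg_pos suminf_nonneg)
  \<comment> \<open>\<open>K\<close> is free of \<open>z\<close>; \<open>X\<close> below carries all
    dependence on its modulus and factors out of the series.\<close>
  define K where "K = (c N + c (Suc N)) * D * exp U"
  have K: "K \<ge> 0"
    using D c by (simp add: K_def less_imp_le add_nonneg_nonneg)
  define X where "X r = (1 + r) ^ M * exp (L * r powr \<alpha>)" for r
  \<comment> \<open>The indices differ by one because the squared weight at \<open>Suc k\<close>
    dominates \<open>b k\<close>.\<close>
  have tail: "(cmod (cpoly (p (n + N)) z))\<^sup>2 \<le> (K * X (cmod z))\<^sup>2 * (1 / b (n + m))" for n z
  proof -
    define r where "r = cmod z"
    define w where "w n = c (N + n) * cmod (cpoly (p (N + n)) z)" for n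
    have w0: "w n \<ge> 0" for n
      using c by (simp add: w_def less_imp_le)
    have "w (Suc (Suc n)) \<le> (u n + r * t n) * w (Suc n) + w n" for n
    proof -
      define j where "j = N + n"
      have j: "j > m" by (simp add: j_def N_def)
      let ?P = "\<lambda>k. cmod (cpoly (p k) z)"
      have tj: "t n = 1 / sqrt (b (Suc j) * b j)" "u n = \<bar>a (Suc j)\<bar> * t n"
        by (simp_all add: t_def u_def j_def)
      have "b (Suc j) * ?P (Suc (Suc j)) = cmod (b (Suc j) * cpoly (p (Suc (Suc j))) z)"
        using pos[of "Suc j"] by (simp add: norm_mult)
      also have "\<dots> \<le> cmod (z - a (Suc j)) * ?P (Suc j) + b j * ?P j"
        unfolding recurrence_coeffs_cpoly[OF rec]
        by (rule order_trans[OF norm_triangle_ineq4]) (use pos[of j] in \<open>simp add: norm_mult\<close>)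
      also have "\<dots> \<le> (r + \<bar>a (Suc j)\<bar>) * ?P (Suc j) + b j * ?P j"
        using norm_triangle_ineq4[of z "complex_of_real (a (Suc j))"]
        by (intro add_right_mono mult_right_mono) (simp_all add: r_def)
      finally have "c (Suc (Suc j)) * (b (Suc j) * ?P (Suc (Suc j))) \<le>
          c (Suc (Suc j)) * ((r + \<bar>a (Suc j)\<bar>) * ?P (Suc j) + b j * ?P j)"
        using c by (intro mult_left_mono) (auto simp: less_imp_le)
      also have "\<dots> = (r + \<bar>a (Suc j)\<bar>) * ?P (Suc j) * c (Suc (Suc j)) + c (Suc (Suc j)) * b j * ?P j"
        by (simp add: algebra_simps)
      \<comment> \<open>\<open>c2\<close> moves the weight to index \<open>Suc j\<close> at the
        price of \<open>t n\<close>; \<open>c1\<close> moves it to index \<open>j\<close> at no cost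
        beyond \<open>b (Suc j)\<close>, which cancels.\<close>
      also have "\<dots> \<le> (r + \<bar>a (Suc j)\<bar>) * ?P (Suc j) * (b (Suc j) * c (Suc j) * t n) + b (Suc j) * c j * ?P j"
      proof (intro add_mono mult_left_mono mult_right_mono c1 j)
        show "c (Suc (Suc j)) \<le> b (Suc j) * c (Suc j) * t n"
          using c2[OF j] pos[of j] pos[of "Suc j"] by (simp add: tj field_simps)
      qed (auto simp: r_def)
      also have "\<dots> = b (Suc j) * ((u n + r * t n) * (c (Suc j) * ?P (Suc j)) + c j * ?P j)"
        by (simp add: tj algebra_simps)
      finally have "b (Suc j) * (c (Suc (Suc j)) * ?P (Suc (Suc j))) \<le> \<dots>"
        by (simp add: mult_ac)
      then show ?thesis
        using pos[of "Suc j"] by (simp add: w_def j_def)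
    qed
    then have "w n \<le> (w 0 + w 1) * (\<Prod>k<n. 1 + (u k + r * t k))"
      using w0 u0 t0 by (intro three_term_inequality_bound) (auto simp: r_def less_imp_le)
    also have "\<dots> \<le> (w 0 + w 1) * exp (U + L * r powr \<alpha>)"
      unfolding U_def L_def using u0 t0 \<alpha> sumu sumt w0
      by (intro mult_left_mono prod_one_plus_le_exp) (auto simp: r_def less_imp_le)
    also have "\<dots> \<le> ((c N + c (Suc N)) * (D * (1 + r) ^ M)) * exp (U + L * r powr \<alpha>)"
    proof (intro mult_right_mono)
      have "w 0 + w 1 \<le> c N * (D * (1 + r) ^ M) + c (Suc N) * (D * (1 + r) ^ M)"
        unfolding w_def r_def using c
        by (intro add_mono mult_mono D) (auto simp: N_def M_def less_imp_le)
      then show "w 0 + w 1 \<le> (c N + c (Suc N)) * (D * (1 + r) ^ M)"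
        by (simp add: algebra_simps)
    qed auto
    also have "\<dots> = K * X r"
      by (simp add: K_def X_def exp_add mult_ac)
    finally have w: "(w n)\<^sup>2 \<le> (K * X r)\<^sup>2"
      using w0 by (intro power_mono) auto
    have "b (m + n) * (cmod (cpoly (p (N + n)) z))\<^sup>2 \<le> (c (N + n))\<^sup>2 * (cmod (cpoly (p (N + n)) z))\<^sup>2"
      using c(2)[of "m + n"] by (intro mult_right_mono) (auto simp: N_def)
    also have "\<dots> \<le> (K * X r)\<^sup>2"
      using w by (simp add: w_def power_mult_distrib)
    finally show ?thesis
      using pos[of "m + n"] by (simp add: r_def field_simps add.commute)
  qed
  have sumb': "summable (\<lambda>n. 1 / b (n + m))"
    using summable_ignore_initial_segment[OF sumb] .
  have summ_tail: "summable (\<lambda>n. (cmod (cpoly (p (n + N)) z))\<^sup>2)" for z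
    by (rule summable_comparison_test'[OF summable_mult[OF sumb', of "(K * X (cmod z))\<^sup>2"]])
       (use tail in auto)
  then have summ: "summable (\<lambda>n. (cmod (cpoly (p n) z))\<^sup>2)" for z
    by (subst (asm) summable_iff_shift)
  \<comment> \<open>The first summand accounts for the \<open>N\<close> initial terms, the second
    for the tail.\<close>
  define F where "F = N * D\<^sup>2 + K\<^sup>2 * (\<Sum>n. 1 / b (n + m))"
  have bound: "(\<Sum>n. (cmod (cpoly (p n) z))\<^sup>2) \<le> F * (X (cmod z))\<^sup>2" for z
  proof -
    have "(\<Sum>n. (cmod (cpoly (p n) z))\<^sup>2) =
        (\<Sum>n. (cmod (cpoly (p (n + N)) z))\<^sup>2) + (\<Sum>n<N. (cmod (cpoly (p n) z))\<^sup>2)"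
      by (rule suminf_split_initial_segment[OF summ])
    also have "(\<Sum>n. (cmod (cpoly (p (n + N)) z))\<^sup>2) \<le> (\<Sum>n. (K * X (cmod z))\<^sup>2 * (1 / b (n + m)))"
      by (intro suminf_le tail summ_tail summable_mult sumb')
    also have "\<dots> = (K * X (cmod z))\<^sup>2 * (\<Sum>n. 1 / b (n + m))"
      by (rule suminf_mult[OF sumb'])
    also have "(\<Sum>n<N. (cmod (cpoly (p n) z))\<^sup>2) \<le> (\<Sum>n<N. (D * X (cmod z))\<^sup>2)"
    proof (intro sum_mono power_mono)
      fix n assume "n \<in> {..<N}"
      then have "cmod (cpoly (p n) z) \<le> D * (1 + cmod z) ^ M"
        by (intro D) (auto simp: N_def M_def)
      also have "\<dots> \<le> D * ((1 + cmod z) ^ M * exp (L * cmod z powr \<alpha>))"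
        using D L mult_left_mono[of 1 "exp (L * cmod z powr \<alpha>)" "(1 + cmod z) ^ M"]
        by (intro mult_left_mono) auto
      finally show "cmod (cpoly (p n) z) \<le> D * X (cmod z)"
        by (simp add: X_def)
    qed auto
    finally show ?thesis
      by (simp add: F_def power_mult_distrib algebra_simps)
  qed
  \<comment> \<open>Adding 1 makes the constant strictly positive, so its logarithm can be split off
    later.\<close>
  have "orthonormal_norm p z \<le> (sqrt F + 1) * X (cmod z)" for z
  proof -
    have X0: "X (cmod z) \<ge> 0" by (simp add: X_def)
    have "orthonormal_norm p z \<le> sqrt (F * (X (cmod z))\<^sup>2)"
      unfolding orthonormal_norm_def by (intro real_sqrt_le_mono bound)
    also have "\<dots> = sqrt F * X (cmod z)"
      using X0 by (simp add: real_sqrt_mult)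
    also have "\<dots> \<le> (sqrt F + 1) * X (cmod z)"
      using X0 by (simp add: algebra_simps)
    finally show ?thesis .
  qed
  moreover have "F \<ge> 0"
    using D pos sumb' by (auto simp: F_def less_imp_le intro!: add_nonneg_nonneg mult_nonneg_nonneg suminf_nonneg)
  ultimately show thesis
    using L summ by (intro that[of "sqrt F + 1" L M]) (auto simp: X_def add_nonneg_pos)
qed

section \<open>Maximum modulus and the lower bound for the growth\<close>

lemma norm_le_max_modulus:
  assumes "bdd_above ((\<lambda>z. norm (f z)) ` cball 0 r)" "cmod z \<le> r"
  shows "norm (f z) \<le> max_modulus f r"
  unfolding max_modulus_def using assms by (intro cSUP_upper) auto

lemma cpoly_le_orthonormal_norm:
  assumes "summable (\<lambda>n. (cmod (cpoly (p n) z))\<^sup>2)"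
  shows "cmod (cpoly (p n) z) \<le> orthonormal_norm p z"
  unfolding orthonormal_norm_def
  using sum_le_suminf[OF assms, of "{n}"] by (intro real_le_rsqrt) auto

text \<open>\<open>G\<close> stands for the maximum modulus. The gap between \<alpha> and \<beta>
  turns linear growth of \<open>b n powr \<alpha>\<close> into comparison with a convergent series
  of exponent \<open>\<beta> / \<alpha> > 1\<close>.\<close>

lemma summable_of_growth:
  fixes b :: "nat \<Rightarrow> real"
  assumes pos: "\<And>n. b n > 0" and lim: "filterlim b at_top sequentially"
    and incr: "\<And>n. n \<ge> m \<Longrightarrow> b n \<le> b (Suc n)"
    and \<alpha>: "0 < \<alpha>" "\<alpha> < \<beta>" and l: "l > 0"
    and bound: "\<And>n r. r > 0 \<Longrightarrow> l * (\<Prod>k<n. r / b k) \<le> G r"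
    and growth: "\<forall>\<^sub>F r in at_top. ln (G r) \<le> r powr \<alpha>"
  shows "summable (\<lambda>n. b n powr (- \<beta>))"
proof -
  have incr': "b k \<le> b n" if "m \<le> k" "k \<le> n" for k n
    using that(2,1) by (induction n rule: dec_induct) (auto intro: order_trans incr)
  have top: "filterlim (\<lambda>n. exp 1 * b n) at_top sequentially"
    by (rule filterlim_tendsto_pos_mult_at_top[OF tendsto_const _ lim]) auto
  \<comment> \<open>Divergence of \<open>b\<close> handles the indices before monotonicity sets in,
    so eventually \<open>b n\<close> is the largest of \<open>b 0\<close>, ...,
    \<open>b n\<close>.\<close>
  have "\<forall>\<^sub>F n in sequentially. \<forall>k\<in>{..<m}. b k \<le> b n"
    by (rule eventually_ball_finite) (use lim in \<open>auto simp: filterlim_at_top\<close>)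
  \<comment> \<open>Absorbs the constant \<open>l\<close> at the cost of half of
    \<open>n\<close>.\<close>
  moreover have "\<forall>\<^sub>F n in sequentially. - ln l \<le> real n / 2"
    by real_asymp
  moreover have "\<forall>\<^sub>F n in sequentially. ln (G (exp 1 * b n)) \<le> (exp 1 * b n) powr \<alpha>"
    using top growth by (rule eventually_compose_filterlim[rotated])
  ultimately have "\<forall>\<^sub>F n in sequentially. b n powr (- \<beta>) \<le>
      (2 * exp \<alpha>) powr (\<beta> / \<alpha>) * real n powr (- (\<beta> / \<alpha>))"
    using eventually_gt_at_top[of 0]
  proof eventually_elim
    case (elim n)
    have le: "b k \<le> b n" if "k \<le> n" for k
      using elim(1) incr' that by (cases "k < m") auto
    define r where "r = exp 1 * b n"
    have r: "r > 0" using pos by (simp add: r_def)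
    have "l * exp (real (Suc n)) = l * (\<Prod>k<Suc n. exp 1)"
      using exp_of_nat_mult[of "Suc n" "1::real"] by (simp only: prod_constant card_lessThan mult_1_right)
    also have "\<dots> \<le> l * (\<Prod>k<Suc n. r / b k)"
    proof (intro mult_left_mono prod_mono conjI)
      fix k assume "k \<in> {..<Suc n}"
      then show "exp 1 \<le> r / b k"
        using le[of k] pos[of k] by (simp add: r_def field_simps)
    qed (use l in auto)
    also have "\<dots> \<le> G r"
      by (rule bound[OF r])
    finally have "ln (l * exp (real (Suc n))) \<le> ln (G r)"
      using l by (subst ln_le_cancel_iff) (auto intro: less_le_trans[rotated])
    then have "ln l + real (Suc n) \<le> r powr \<alpha>"
      using elim(3) l by (simp add: ln_mult r_def)
    then have "real n / 2 \<le> r powr \<alpha>"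
      using elim(2) by simp
    also have "r powr \<alpha> = exp \<alpha> * b n powr \<alpha>"
      using pos[of n] by (simp add: r_def powr_mult exp_powr_real)
    finally have "b n powr (- \<alpha>) \<le> 2 * exp \<alpha> * real n powr (- 1)"
      using pos[of n] elim(4) by (simp add: powr_minus field_simps)
    then have "(b n powr (- \<alpha>)) powr (\<beta> / \<alpha>) \<le> (2 * exp \<alpha> * real n powr (- 1)) powr (\<beta> / \<alpha>)"
      using \<alpha> by (intro powr_mono2) auto
    also have "\<dots> = (2 * exp \<alpha>) powr (\<beta> / \<alpha>) * (real n powr (- 1)) powr (\<beta> / \<alpha>)"
      by (rule powr_mult)
    finally have "b n powr (- \<alpha> * (\<beta> / \<alpha>)) \<le>
        (2 * exp \<alpha>) powr (\<beta> / \<alpha>) * real n powr (- 1 * (\<beta> / \<alpha>))"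
      by (simp only: powr_powr)
    moreover have "- \<alpha> * (\<beta> / \<alpha>) = - \<beta>"
      using \<alpha> by simp
    ultimately show ?case
      by (simp only: mult_minus1)
  qed
  then have ev: "\<forall>\<^sub>F n in sequentially. norm (b n powr (- \<beta>)) \<le>
      (2 * exp \<alpha>) powr (\<beta> / \<alpha>) * real n powr (- (\<beta> / \<alpha>))"
    by simp
  have "summable (\<lambda>n. (2 * exp \<alpha>) powr (\<beta> / \<alpha>) * real n powr (- (\<beta> / \<alpha>)))"
    using \<alpha> by (intro summable_mult) (simp add: summable_real_powr_iff)
  with ev show ?thesis
    by (rule summable_comparison_test_ev)
qed

text \<open>The majorant increases with the modulus of \<open>z\<close>, so its value at
  \<open>r\<close> bounds the whole disc and the real supremum is meaningful.\<close>

lemma orthonormal_norm_bounded: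
  assumes "r \<ge> 0" "E > 0" "L \<ge> 0" "\<alpha> > 0"
    and summ: "\<And>z. summable (\<lambda>n. (cmod (cpoly (p n) z))\<^sup>2)"
    and le: "\<And>z. orthonormal_norm p z \<le> E * ((1 + cmod z) ^ M * exp (L * cmod z powr \<alpha>))"
  shows "bdd_above ((\<lambda>z. norm (orthonormal_norm p z)) ` cball 0 r)"
    and "max_modulus (orthonormal_norm p) r \<le> E * ((1 + r) ^ M * exp (L * r powr \<alpha>))"
proof -
  have *: "norm (orthonormal_norm p z) \<le> E * ((1 + r) ^ M * exp (L * r powr \<alpha>))"
    if "z \<in> cball 0 r" for z
  proof -
    have "orthonormal_norm p z \<ge> 0"
      unfolding orthonormal_norm_def using summ by (simp add: suminf_nonneg)
    then have "norm (orthonormal_norm p z) \<le> E * ((1 + cmod z) ^ M * exp (L * cmod z powr \<alpha>))"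
      using le[of z] by simp
    also have "\<dots> \<le> E * ((1 + r) ^ M * exp (L * r powr \<alpha>))"
    proof -
      have "L * cmod z powr \<alpha> \<le> L * r powr \<alpha>" "(1 + cmod z) ^ M \<le> (1 + r) ^ M"
        using assms(1-4) that by (auto intro!: mult_left_mono powr_mono2 power_mono)
      then show ?thesis
        using assms(1-4) by (intro mult_left_mono mult_mono) simp_all
    qed
    finally show ?thesis .
  qed
  show "bdd_above ((\<lambda>z. norm (orthonormal_norm p z)) ` cball 0 r)"
    by (rule bdd_aboveI2) (rule *)
  show "max_modulus (orthonormal_norm p) r \<le> E * ((1 + r) ^ M * exp (L * r powr \<alpha>))"
    unfolding max_modulus_def using assms(1) by (intro cSUP_least *) auto
qed

section \<open>Equality of the order and the exponent of convergence\<close>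

theorem theorem4p11:
  fixes s :: "nat \<Rightarrow> real" and \<mu> :: "real measure"
    and p :: "nat \<Rightarrow> real poly" and a b :: "nat \<Rightarrow> real"
  assumes "normalized_hamburger_problem s \<mu>"
    and "orthonormal_polys \<mu> p"
    and "recurrence_coeffs p a b"
    and "summable (\<lambda>n. (1 + \<bar>a (Suc n)\<bar>) / sqrt (b (Suc n) * b n))"
    and "\<exists>n0\<ge>1. (\<forall>n\<ge>n0. (b n)\<^sup>2 \<le> b (n - 1) * b (n + 1)) \<or>
                 (\<forall>n\<ge>n0. (b n)\<^sup>2 \<ge> b (n - 1) * b (n + 1))"
  shows "moment_problem_order p = exponent_of_convergence b"
proof -
  note rec = assms(3)
  note pos = recurrence_coeffs_pos[OF rec]
  have deg: "degree (p n) = n" and lead: "lead_coeff (p n) > 0" for n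
    using assms(2) unfolding orthonormal_polys_def by blast+
  obtain n0 where "(\<forall>n\<ge>n0. (b n)\<^sup>2 \<le> b (n - 1) * b (n + 1)) \<or>
                 (\<forall>n\<ge>n0. (b n)\<^sup>2 \<ge> b (n - 1) * b (n + 1))"
    using assms(5) by blast
  then have mon0: "(\<forall>n\<ge>n0. (b (Suc n))\<^sup>2 \<le> b n * b (Suc (Suc n))) \<or>
              (\<forall>n\<ge>n0. (b (Suc n))\<^sup>2 \<ge> b n * b (Suc (Suc n)))"
    by (metis Suc_eq_plus1 diff_Suc_1 le_SucI)
  have sums: "summable (\<lambda>n. 1 / sqrt (b (Suc n) * b n))"
    by (rule summable_comparison_test'[OF assms(4)])
       (use pos in \<open>auto intro!: divide_right_mono simp: less_imp_le\<close>)
  obtain m where m: "m \<ge> n0" and incr: "\<And>n. n \<ge> m \<Longrightarrow> b n \<le> b (Suc n)"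
    using eventually_mono_of_log_monotone[OF pos sums mon0] by blast
  have mon: "(\<forall>n\<ge>m. (b (Suc n))\<^sup>2 \<le> b n * b (Suc (Suc n))) \<or>
              (\<forall>n\<ge>m. (b (Suc n))\<^sup>2 \<ge> b n * b (Suc (Suc n)))"
    using mon0 m by (meson order_trans)
  \<comment> \<open>Beyond \<open>m\<close> the larger factor \<open>b (Suc n)\<close> bounds the
    geometric mean from above.\<close>
  have "summable (\<lambda>n. 1 / b (Suc n))"
  proof (rule summable_comparison_test'[OF sums])
    fix n assume "n \<ge> m"
    then have "b (Suc n) * b n \<le> b (Suc n) * b (Suc n)"
      using pos incr by (intro mult_left_mono) (auto simp: less_imp_le)
    then have "sqrt (b (Suc n) * b n) \<le> b (Suc n)"
      using pos[of "Suc n"] by (intro real_le_lsqrt) (auto simp: power2_eq_square)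
    then show "norm (1 / b (Suc n)) \<le> 1 / sqrt (b (Suc n) * b n)"
      using pos by (simp add: less_imp_le frac_le)
  qed
  then have sumb: "summable (\<lambda>n. 1 / b n)"
    by (subst (asm) summable_Suc_iff)
  have lim: "filterlim b at_top sequentially"
  proof -
    have "(\<lambda>n. inverse (b n)) \<longlonglongrightarrow> 0"
      using summable_LIMSEQ_zero[OF sumb] by (simp add: inverse_eq_divide)
    then have "filterlim (\<lambda>n. inverse (inverse (b n))) at_top sequentially"
      by (rule filterlim_inverse_at_top) (use pos in auto)
    then show ?thesis by simp
  qed

  define G where "G = {\<alpha>. \<alpha> > 0 \<and>
    (\<forall>\<^sub>F r in at_top. ln (max_modulus (orthonormal_norm p) r) \<le> r powr \<alpha>)}"
  define A where "A = {\<alpha>. \<alpha> > 0 \<and>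
    (\<exists>N. (\<forall>n\<ge>N. norm (b n) > 0) \<and> summable (\<lambda>n. norm (b (n + N)) powr (- \<alpha>)))}"
  have A: "\<alpha> \<in> A \<longleftrightarrow> \<alpha> > 0 \<and> summable (\<lambda>n. b n powr (- \<alpha>))" for \<alpha>
  proof -
    have "(\<lambda>n. norm (b (n + N)) powr (- \<alpha>)) = (\<lambda>n. b (n + N) powr (- \<alpha>))" for N
      using pos by (simp add: less_imp_le)
    then show ?thesis
      using pos summable_iff_shift[of "\<lambda>n. b n powr (- \<alpha>)"]
      by (auto simp: A_def less_imp_neq[THEN not_sym])
  qed
  have sum1: "summable (\<lambda>n. b n powr (- 1))"
    using sumb pos by (simp add: powr_minus_divide less_imp_le)
  note growth = orthonormal_norm_growth[OF rec deg assms(4) incr mon sumb]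

  \<comment> \<open>Exponent 1 is always available and gives convergence of the series and
    boundedness on discs.\<close>
  obtain E1 L1 M1 where g1: "E1 > 0" "L1 \<ge> 0"
    "\<And>z. summable (\<lambda>n. (cmod (cpoly (p n) z))\<^sup>2)"
    "\<And>z. orthonormal_norm p z \<le> E1 * ((1 + cmod z) ^ M1 * exp (L1 * cmod z powr 1))"
    using growth[OF _ zero_less_one order_refl sum1] by blast
  have bdd: "bdd_above ((\<lambda>z. norm (orthonormal_norm p z)) ` cball 0 r)" if "r \<ge> 0" for r
    using orthonormal_norm_bounded(1)[OF that g1(1,2) _ g1(3,4)] by simp
  have ge: "cmod (cpoly (p n) z) \<le> max_modulus (orthonormal_norm p) r" if "cmod z \<le> r" for n z r
  proof -
    have "cmod (cpoly (p n) z) \<le> norm (orthonormal_norm p z)"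
      using cpoly_le_orthonormal_norm[OF g1(3), of n z] by simp
    also have "\<dots> \<le> max_modulus (orthonormal_norm p) r"
      using that order_trans[OF norm_ge_zero that] by (intro norm_le_max_modulus bdd)
    finally show ?thesis .
  qed
  have lower: "lead_coeff (p 0) * (\<Prod>k<n. r / b k) \<le> max_modulus (orthonormal_norm p) r"
    if "r > 0" for n r
  proof -
    have "lead_coeff (p 0) * (\<Prod>k<n. r / b k) = lead_coeff (p n) * (\<Prod>k<n. b k) * (r ^ n / (\<Prod>k<n. b k))"
      by (simp only: lead_coeff_times_prod[OF rec deg] prod_dividef prod_constant card_lessThan)
    also have "\<dots> = lead_coeff (p n) * r ^ n"
      using pos by (simp add: less_imp_neq[THEN not_sym])
    also have "\<dots> = cmod (coeff (map_poly of_real (p n)) n) * r ^ n"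
      using lead[of n] by (simp add: coeff_map_poly deg)
    also have "\<dots> \<le> max_modulus (orthonormal_norm p) r"
      using that ge by (intro coeff_le_of_bound_on_circle) auto
    finally show ?thesis .
  qed

  have "Inf (ereal ` G) \<le> Inf (ereal ` A)"
  proof (rule Inf_ereal_image_le)
    fix x y assume "x \<in> A" "x < y"
    \<comment> \<open>The growth bound requires an exponent at most 1, and \<open>sum1\<close>
      allows the truncation.\<close>
    define \<alpha> where "\<alpha> = min x 1"
    have \<alpha>: "0 < \<alpha>" "\<alpha> \<le> 1" "\<alpha> < y" "summable (\<lambda>n. b n powr (- \<alpha>))"
      using \<open>x \<in> A\<close> \<open>x < y\<close> sum1 by (auto simp: \<alpha>_def A min_def)
    obtain E L M where g: "E > 0" "L \<ge> 0"
      "\<And>z. summable (\<lambda>n. (cmod (cpoly (p n) z))\<^sup>2)"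
      "\<And>z. orthonormal_norm p z \<le> E * ((1 + cmod z) ^ M * exp (L * cmod z powr \<alpha>))"
      using growth[OF _ \<alpha>(1,2,4)] by blast
    \<comment> \<open>Since \<open>\<alpha> < y\<close>, the constants and the polynomial factor are
      absorbed.\<close>
    have "\<forall>\<^sub>F r in at_top. ln E + (real M * ln (1 + r) + L * r powr \<alpha>) \<le> r powr y"
      using \<alpha> by real_asymp
    then have "\<forall>\<^sub>F r in at_top. ln (max_modulus (orthonormal_norm p) r) \<le> r powr y"
      using eventually_gt_at_top[of 0]
    proof eventually_elim
      case (elim r)
      \<comment> \<open>The case \<open>n = 0\<close> makes the maximum modulus positive, as
        monotonicity of \<open>ln\<close> requires.\<close>
      have "lead_coeff (p 0) \<le> max_modulus (orthonormal_norm p) r"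
        using lower[OF elim(2), of 0] by simp
      then have "ln (max_modulus (orthonormal_norm p) r) \<le> ln (E * ((1 + r) ^ M * exp (L * r powr \<alpha>)))"
        using lead[of 0] orthonormal_norm_bounded(2)[OF _ g(1,2) \<alpha>(1) g(3,4), of r] elim(2) g(1)
        by (subst ln_le_cancel_iff) auto
      also have "\<dots> = ln E + (real M * ln (1 + r) + L * r powr \<alpha>)"
        using elim(2) g(1) by (simp add: ln_mult ln_realpow)
      finally show ?case using elim(1) by simp
    qed
    then show "y \<in> G"
      using \<alpha> by (simp add: G_def)
  qed
  moreover have "Inf (ereal ` A) \<le> Inf (ereal ` G)"
  proof (rule Inf_ereal_image_le)
    fix x y assume "x \<in> G" "x < y"
    then have "0 < x" "\<forall>\<^sub>F r in at_top. ln (max_modulus (orthonormal_norm p) r) \<le> r powr x"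
      by (auto simp: G_def)
    then show "y \<in> A"
      using summable_of_growth[OF pos lim incr _ \<open>x < y\<close> lead[of 0] lower] \<open>x < y\<close> by (simp add: A)
  qed
  ultimately show ?thesis
    unfolding moment_problem_order_def growth_order_def exponent_of_convergence_def G_def A_def
    by (rule antisym)
qed

end
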